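(* For $n\ge1$ let $V_n:=\sum_{w\in\mathcal F_{n,2}}\mathrm{ver}(G(w))$ and $D^{(3)}_n:=\sum_{w\in\mathcal F_{n,2}}\deg_3(G(w))$. Then $$\lim_{n\to\infty}\frac{D^{(3)}_n}{V_n}=\frac{4+\sqrt5}{11}.$$
   Context: $\mathcal F_{n,2}$ is the set of binary words $w=w_1\cdots w_n$ with no two consecutive $1$'s. $P(w)$ is the bargraph polyomino formed by the unit squares $[i-1,i]\times[j-1,j]$, $1\le i\le n$, $1\le j\le w_i+1$. $G(w)$ is the graph whose vertices are the corners of the cells of $P(w)$ and whose edges are the cell sides. $\mathrm{ver}(G)$ is the number of vertices of $G$ and $\deg_3(G)$ the number of vertices of degree $3$. *)

theory Defs
  imports Complex_Main
begin

definition fib_words :: "nat \<Rightarrow> nat list set" where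
  "fib_words n = {w. length w = n \<and> set w \<subseteq> {0, 1} \<and>
     (\<forall>i. Suc i < n \<longrightarrow> \<not> (w ! i = 1 \<and> w ! Suc i = 1))}"

lemma finite_fib_words: "finite (fib_words n)"
  by (rule finite_subset[OF _ finite_lists_length_eq[of "{0, 1}" n]])
     (auto simp: fib_words_def)

text \<open>
  The pair \<open>(i, j)\<close> stands for the unit square \<open>[i, i+1] \<times> [j, j+1]\<close>; columns and rows are
  counted from 0, so the letter of column \<open>i\<close> is \<open>w ! i\<close>.
\<close>

definition bargraph_cells :: "nat list \<Rightarrow> (nat \<times> nat) set" where
  "bargraph_cells w = {(i, j). i < length w \<and> j < w ! i + 1}"

definition cell_corners :: "nat \<times> nat \<Rightarrow> (nat \<times> nat) set" where
  "cell_corners = (\<lambda>(i, j). {(i, j), (i + 1, j), (i, j + 1), (i + 1, j + 1)})"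

definition cell_sides :: "nat \<times> nat \<Rightarrow> (nat \<times> nat) set set" where
  "cell_sides = (\<lambda>(i, j).
     {{(i, j), (i + 1, j)}, {(i, j + 1), (i + 1, j + 1)},
      {(i, j), (i, j + 1)}, {(i + 1, j), (i + 1, j + 1)}})"

text \<open>A graph is a pair of a vertex set and a set of two-element vertex sets.\<close>

type_synonym 'v graph = "'v set \<times> 'v set set"

definition ver :: "'v graph \<Rightarrow> nat" where
  "ver G = card (fst G)"

definition degree :: "'v graph \<Rightarrow> 'v \<Rightarrow> nat" where
  "degree G v = card {e \<in> snd G. v \<in> e}"

definition deg3 :: "'v graph \<Rightarrow> nat" where
  "deg3 G = card {v \<in> fst G. degree G v = 3}"

definition bargraph :: "nat list \<Rightarrow> (nat \<times> nat) graph" where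
  "bargraph w =
     (\<Union>c\<in>bargraph_cells w. cell_corners c, \<Union>c\<in>bargraph_cells w. cell_sides c)"

definition V_total :: "nat \<Rightarrow> nat" where
  "V_total n = (\<Sum>w\<in>fib_words n. ver (bargraph w))"

definition D3_total :: "nat \<Rightarrow> nat" where
  "D3_total n = (\<Sum>w\<in>fib_words n. deg3 (bargraph w))"

end

theory Submission
  imports Defs "HOL-Number_Theory.Fib"
begin

text \<open>
  If \<open>w\<close> has \<open>n\<close> letters, \<open>k\<close> of them equal to 1, then \<open>G(w)\<close> has \<open>2(n + 1) + 2k\<close> vertices. Away from
  the two ends, a vertex on level 0 has degree 3, a vertex on level 1 has degree 3 unless one of the
  \<open>2k\<close> vertical edges above level 1 starts there, and a vertex on level 2 has degree 2; so
  \<open>2n - 2k\<close> vertices have degree 3, up to a bounded error. The number \<open>F\<^sub>n\<close> of words is a Fibonacci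
  number, and the total number \<open>K\<^sub>n\<close> of ones satisfies
  \<open>5 K\<^sub>n = n (3 F\<^sub>n - F\<^sub>n\<^sub>+\<^sub>1) + 4 F\<^sub>n - 2 F\<^sub>n\<^sub>+\<^sub>1\<close>. Hence \<open>K\<^sub>n / (n F\<^sub>n)\<close> tends to
  \<open>p = (3 - \<phi>) / 5\<close>, where \<open>\<phi>\<close> is the golden ratio, and the quotient tends to \<open>(1 - p) / (1 + p)\<close>.
\<close>

section \<open>Counting words and ones\<close>

lemma fib_words_0: "fib_words 0 = {[]}"
  by (auto simp: fib_words_def)

lemma fib_words_Suc_0: "fib_words (Suc 0) = {[0], [1]}"
  by (auto simp: fib_words_def length_Suc_conv)

lemma Cons_0_in_fib_words_iff: "0 # w \<in> fib_words (Suc n) \<longleftrightarrow> w \<in> fib_words n"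
  by (auto simp: fib_words_def nth_Cons split: nat.splits)

lemma Cons_1_0_in_fib_words_iff: "1 # 0 # w \<in> fib_words (Suc (Suc n)) \<longleftrightarrow> w \<in> fib_words n"
  by (auto simp: fib_words_def nth_Cons split: nat.splits)

text \<open>A leading 1 forces a following 0, so cutting off the block 0 or 10 leaves an arbitrary
  shorter word; this is the Fibonacci recursion.\<close>

lemma fib_words_Suc_Suc:
  "fib_words (Suc (Suc n)) =
     Cons 0 ` fib_words (Suc n) \<union> (\<lambda>w. 1 # 0 # w) ` fib_words n" (is "?L = ?R")
proof
  show "?R \<subseteq> ?L"
    using Cons_0_in_fib_words_iff Cons_1_0_in_fib_words_iff by blast
  show "?L \<subseteq> ?R"
  proof
    fix w assume w: "w \<in> ?L"
    then obtain a b v where v: "w = a # b # v"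
      by (auto simp: fib_words_def length_Suc_conv)
    have "a \<in> {0, 1}" "b \<in> {0, 1}" using w v by (auto simp: fib_words_def)
    moreover have "\<not> (a = 1 \<and> b = 1)" using w v by (force simp: fib_words_def)
    ultimately consider "a = 0" | "a = 1" "b = 0" by auto
    then show "w \<in> ?R"
      using w v Cons_0_in_fib_words_iff Cons_1_0_in_fib_words_iff by cases auto
  qed
qed

lemma sum_fib_words_Suc_Suc:
  "(\<Sum>w\<in>fib_words (Suc (Suc n)). f w) =
     (\<Sum>w\<in>fib_words (Suc n). f (0 # w)) + (\<Sum>w\<in>fib_words n. f (1 # 0 # w))"
  unfolding fib_words_Suc_Suc
  by (subst sum.union_disjoint) (auto simp: finite_fib_words sum.reindex inj_on_def)

text \<open>The index shift matches the initial counts 1 and 2 with \<open>fib 2\<close> and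
  \<open>fib 3\<close>.\<close>

lemma card_fib_words: "card (fib_words n) = fib (n + 2)"
proof (induction n rule: fib.induct)
  case (3 n)
  have "card (fib_words (Suc (Suc n))) = card (fib_words (Suc n)) + card (fib_words n)"
    using sum_fib_words_Suc_Suc[of "\<lambda>_. 1::nat" n] by simp
  with 3 show ?case by simp
qed (simp_all add: fib_words_0 fib_words_Suc_0 numeral_2_eq_2)

text \<open>Prefixing 10 adds a one to each of \<open>fib (n + 2)\<close> words, so the totals obey
  the Fibonacci recursion with a Fibonacci inhomogeneity. This resonance produces the factor
  \<open>n\<close>.\<close>

lemma sum_ones_fib_words:
  "5 * real (\<Sum>w\<in>fib_words n. sum_list w) =
     real n * (3 * real (fib (n + 2)) - real (fib (n + 3)))
     + 4 * real (fib (n + 2)) - 2 * real (fib (n + 3))"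
proof (induction n rule: fib.induct)
  case (3 n)
  have "(\<Sum>w\<in>fib_words (Suc (Suc n)). sum_list w) =
      (\<Sum>w\<in>fib_words (Suc n). sum_list w) + (\<Sum>w\<in>fib_words n. sum_list w) + fib (n + 2)"
    by (simp add: sum_fib_words_Suc_Suc sum_Suc card_fib_words)
  with 3 show ?case by (simp add: eval_nat_numeral algebra_simps)
qed (simp_all add: fib_words_0 fib_words_Suc_0 eval_nat_numeral)

section \<open>Fibonacci ratios and the limiting density of ones\<close>

lemma fib_ratio_tendsto:
  "(\<lambda>n. real (fib (Suc n)) / real (fib n)) \<longlonglongrightarrow> (1 + sqrt 5) / 2"
proof -
  define \<phi> :: real where "\<phi> = (1 + sqrt 5) / 2"
  \<comment> \<open>The quotient of \<open>fib n\<close> by its leading Binet term; in consecutive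
    quotients the powers cancel up to one factor \<open>\<phi>\<close>.\<close>
  define g where "g n = real (fib n) / (1 / sqrt 5 * \<phi> ^ n)" for n
  have pos: "\<phi> > 0" unfolding \<phi>_def by (simp add: add_pos_pos)
  have g: "g \<longlonglongrightarrow> 1"
    using fib_asymptotics unfolding g_def \<phi>_def by simp
  have "(\<lambda>n. \<phi> * (g (Suc n) / g n)) \<longlonglongrightarrow> \<phi> * (1 / 1)"
    by (intro tendsto_intros g LIMSEQ_Suc) auto
  \<comment> \<open>This includes \<open>n = 0\<close>: both sides are divisions by 0 and hence
    0.\<close>
  moreover have "\<phi> * (g (Suc n) / g n) = real (fib (Suc n)) / real (fib n)" for n
    using pos by (simp add: g_def)
  ultimately show ?thesis unfolding \<phi>_def by simp
qed

lemma ones_density_tendsto: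
  "(\<lambda>n. real (\<Sum>w\<in>fib_words n. sum_list w) / (real n * real (card (fib_words n))))
     \<longlonglongrightarrow> (5 - sqrt 5) / 10"
proof -
  define r where "r n = real (fib (n + 3)) / real (fib (n + 2))" for n
  have r: "r \<longlonglongrightarrow> (1 + sqrt 5) / 2"
  proof -
    have "r = (\<lambda>n. real (fib (Suc (n + 2))) / real (fib (n + 2)))"
      by (simp add: r_def fun_eq_iff eval_nat_numeral)
    then show ?thesis
      using LIMSEQ_ignore_initial_segment[OF fib_ratio_tendsto, of 2] by (simp only:)
  qed
  \<comment> \<open>The closed form for the number of ones, divided by 5 times \<open>n\<close>
    times the number of words.\<close>
  have "(\<lambda>n. ((3 - r n) + (4 - 2 * r n) * (1 / real n)) / 5)
      \<longlonglongrightarrow> ((3 - (1 + sqrt 5) / 2) + (4 - 2 * ((1 + sqrt 5) / 2)) * 0) / 5"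
    by (intro tendsto_intros r lim_1_over_n) auto
  moreover have "\<forall>\<^sub>F n in sequentially. ((3 - r n) + (4 - 2 * r n) * (1 / real n)) / 5 =
      real (\<Sum>w\<in>fib_words n. sum_list w) / (real n * real (card (fib_words n)))"
    using eventually_gt_at_top[of 0]
  proof eventually_elim
    case (elim n)
    have solve: "((3 - b / a) + (4 - 2 * (b / a)) * (1 / m)) / 5 = S / (m * a)"
      if "5 * S = m * (3 * a - b) + 4 * a - 2 * b" "a > 0" "m > 0" for a b m S :: real
    proof -
      have "S = (m * (3 * a - b) + 4 * a - 2 * b) / 5" using that by simp
      then show ?thesis using that(2,3) by (simp add: divide_simps)
    qed
    have "real (fib (n + 2)) > 0"
      unfolding of_nat_0_less_iff by (rule fib_neq_0_nat) simp
    from solve[OF sum_ones_fib_words this] show ?case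
      using elim unfolding card_fib_words r_def by simp
  qed
  ultimately have "(\<lambda>n. real (\<Sum>w\<in>fib_words n. sum_list w) / (real n * real (card (fib_words n))))
      \<longlonglongrightarrow> ((3 - (1 + sqrt 5) / 2) + (4 - 2 * ((1 + sqrt 5) / 2)) * 0) / 5"
    by (rule Lim_transform_eventually)
  moreover have "((3 - (1 + sqrt 5) / 2) + (4 - 2 * ((1 + sqrt 5) / 2)) * 0) / 5 = (5 - sqrt 5) / 10"
    by (simp add: field_simps)
  ultimately show ?thesis by (simp only:)
qed

section \<open>Vertices and degrees of a bargraph\<close>

text \<open>Sides are indexed by their left or lower end, so distinct indices give distinct edges
  and degrees become counts of indices.\<close>

definition hedge :: "nat \<Rightarrow> nat \<Rightarrow> (nat \<times> nat) set" where
  "hedge i j = {(i, j), (Suc i, j)}"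

definition vedge :: "nat \<Rightarrow> nat \<Rightarrow> (nat \<times> nat) set" where
  "vedge i j = {(i, j), (i, Suc j)}"

lemma in_hedge_iff: "(x, y) \<in> hedge i j \<longleftrightarrow> y = j \<and> (x = i \<or> x = Suc i)"
  by (auto simp: hedge_def)

lemma in_vedge_iff: "(x, y) \<in> vedge i j \<longleftrightarrow> x = i \<and> (y = j \<or> y = Suc j)"
  by (auto simp: vedge_def)

lemma hedge_eq_iff: "hedge i j = hedge i' j' \<longleftrightarrow> i = i' \<and> j = j'"
  by (auto simp: hedge_def doubleton_eq_iff)

lemma vedge_eq_iff: "vedge i j = vedge i' j' \<longleftrightarrow> i = i' \<and> j = j'"
  by (auto simp: vedge_def doubleton_eq_iff)

lemma hedge_neq_vedge: "hedge i j \<noteq> vedge i' j'" "vedge i' j' \<noteq> hedge i j"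
  by (auto simp: hedge_def vedge_def doubleton_eq_iff)

lemma edges_bargraph:
  "e \<in> snd (bargraph w) \<longleftrightarrow>
     (\<exists>i j. e = hedge i j \<and> i < length w \<and> j \<le> w ! i + 1) \<or>
     (\<exists>i j c. e = vedge i j \<and> c < length w \<and> (i = c \<or> i = Suc c) \<and> j \<le> w ! c)"
  (is "?L \<longleftrightarrow> ?R")
proof
  show "?L \<Longrightarrow> ?R"
    unfolding bargraph_def bargraph_cells_def cell_sides_def hedge_def vedge_def
    by (auto; fastforce)
next
  have cell: "cell_sides (c, j) \<subseteq> snd (bargraph w)" if "c < length w" "j \<le> w ! c" for c j
    proof -
    have "(c, j) \<in> bargraph_cells w" using that by (simp add: bargraph_cells_def)
    then show ?thesis unfolding bargraph_def snd_conv by (rule UN_upper)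
  qed
  assume ?R
  then show ?L
  proof (elim disjE exE conjE)
    fix i j assume e: "e = hedge i j" and i: "i < length w" and j: "j \<le> w ! i + 1"
    show ?L
    \<comment> \<open>A side on level 0 is the bottom of the lowest cell; any higher one is the top
      of the cell below it.\<close>
    proof (cases j)
      case 0
      then show ?thesis using cell[of i 0] e i by (auto simp: cell_sides_def hedge_def)
    next
      case (Suc j')
      then show ?thesis using cell[of i j'] e i j by (auto simp: cell_sides_def hedge_def)
    qed
  next
    fix i j c assume "e = vedge i j" "c < length w" "j \<le> w ! c" "i = c"
    then show ?L using cell[of c j] by (auto simp: cell_sides_def vedge_def)
  next
    fix i j c assume "e = vedge i j" "c < length w" "j \<le> w ! c" "i = Suc c"
    then show ?L using cell[of c j] by (auto simp: cell_sides_def vedge_def)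
  qed
qed

section \<open>Peaks and vertices for a fixed word\<close>

context
  fixes w :: "nat list" and n :: nat
  assumes w: "w \<in> fib_words n" and n_pos: "n > 0"
begin

definition peaks :: "nat set" where
  "peaks = {i. i < n \<and> w ! i = 1}"

text \<open>Abscissas of the vertical lines bounding a column of height 2; exactly these carry
  vertices on level 2.\<close>

definition peak_sides :: "nat set" where
  "peak_sides = peaks \<union> Suc ` peaks"

lemma length_w: "length w = n"
  using w by (simp add: fib_words_def)

lemma letter_cases: "i < n \<Longrightarrow> w ! i = 0 \<or> w ! i = 1"
  using w nth_mem[of i w] unfolding fib_words_def by blast

lemma letter_eq: "i < n \<Longrightarrow> w ! i = (if i \<in> peaks then 1 else 0)"
  using letter_cases by (auto simp: peaks_def)

lemma peaks_less: "i \<in> peaks \<Longrightarrow> i < n"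
  by (simp add: peaks_def)

lemma Suc_notin_peaks: "i \<in> peaks \<Longrightarrow> Suc i \<notin> peaks"
  using w by (auto simp: fib_words_def peaks_def)

lemma finite_peaks: "finite peaks"
  by (rule finite_subset[of _ "{..<n}"]) (auto simp: peaks_def)

lemma finite_peak_sides: "finite peak_sides"
  by (simp add: peak_sides_def finite_peaks)

lemma card_peaks: "card peaks = sum_list w"
proof -
  have "sum_list w = (\<Sum>i<n. w ! i)"
    by (simp add: sum_list_sum_nth length_w atLeast0LessThan)
  also have "\<dots> = (\<Sum>i<n. if i \<in> peaks then 1 else 0)"
    by (intro sum.cong) (auto simp: letter_eq)
  also have "\<dots> = card ({..<n} \<inter> peaks)"
    by (simp add: sum.If_cases)
  also have "{..<n} \<inter> peaks = peaks" by (auto simp: peaks_def)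
  finally show ?thesis by simp
qed

text \<open>Since no two ones are adjacent, the right side of one peak is never the left side of
  another.\<close>

lemma card_peak_sides: "card peak_sides = 2 * sum_list w"
proof -
  have "card peak_sides = card peaks + card (Suc ` peaks)"
    unfolding peak_sides_def
    by (rule card_Un_disjoint) (auto simp: finite_peaks Suc_notin_peaks)
  then show ?thesis by (simp add: card_image card_peaks)
qed

lemma peak_sides_subset: "peak_sides \<subseteq> {..n}"
  by (auto simp: peak_sides_def peaks_def)

text \<open>A point on levels 0 and 1 is a left corner of its own column, except on the line
  \<open>n\<close>, where column \<open>n - 1\<close> supplies it; this needs
  \<open>n > 0\<close>.\<close>

lemma vertices_bargraph: "fst (bargraph w) = {..n} \<times> {0, 1} \<union> peak_sides \<times> {2}"
proof (intro set_eqI iffI)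
  fix v assume "v \<in> fst (bargraph w)"
  then obtain i j where ij: "i < n" "j \<le> w ! i" "v \<in> cell_corners (i, j)"
    by (auto simp: bargraph_def bargraph_cells_def length_w less_Suc_eq_le)
  then show "v \<in> {..n} \<times> {0, 1} \<union> peak_sides \<times> {2}"
    by (auto simp: cell_corners_def letter_eq peak_sides_def split: if_splits)
next
  have cell: "cell_corners (c, j) \<subseteq> fst (bargraph w)" if "c < n" "j \<le> w ! c" for c j
    proof -
    have "(c, j) \<in> bargraph_cells w" using that by (simp add: bargraph_cells_def length_w)
    then show ?thesis unfolding bargraph_def fst_conv by (rule UN_upper)
  qed
  fix v :: "nat \<times> nat" assume "v \<in> {..n} \<times> {0, 1} \<union> peak_sides \<times> {2}"
  then obtain x y where v: "v = (x, y)"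
    and xy: "x \<le> n \<and> (y = 0 \<or> y = 1) \<or> x \<in> peak_sides \<and> y = 2" by auto
  from xy consider "x < n" "y = 0 \<or> y = 1" | "x = n" "y = 0 \<or> y = 1"
    | "x \<in> peaks" "y = 2" | c where "x = Suc c" "c \<in> peaks" "y = 2"
    unfolding peak_sides_def by (auto simp: le_less)
  then show "v \<in> fst (bargraph w)"
  proof cases
    case 1
    then show ?thesis using cell[of x 0] v by (auto simp: cell_corners_def)
  next
    case 2
    then show ?thesis using cell[of "n - 1" 0] v n_pos by (auto simp: cell_corners_def)
  next
    case 3
    then show ?thesis using cell[of x 1] v by (auto simp: cell_corners_def peaks_def numeral_2_eq_2)
  next
    case 4
    then show ?thesis using cell[of c 1] v by (auto simp: cell_corners_def peaks_def numeral_2_eq_2)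
  qed
qed

lemma ver_bargraph: "ver (bargraph w) = 2 * (n + 1) + 2 * sum_list w"
proof -
  have "card ({..n} \<times> {0, 1} \<union> peak_sides \<times> {2::nat}) =
      card ({..n} \<times> {0, 1::nat}) + card (peak_sides \<times> {2::nat})"
    by (rule card_Un_disjoint) (auto simp: finite_peak_sides)
  then show ?thesis
    by (simp add: ver_def vertices_bargraph card_cartesian_product card_peak_sides)
qed

section \<open>Edges and degrees by level\<close>

lemma edges_fib_bargraph:
  "e \<in> snd (bargraph w) \<longleftrightarrow>
     (\<exists>i<n. e = hedge i 0 \<or> e = hedge i 1) \<or> (\<exists>i\<in>peaks. e = hedge i 2) \<or>
     (\<exists>i\<le>n. e = vedge i 0) \<or> (\<exists>i\<in>peak_sides. e = vedge i 1)"
  (is "_ \<longleftrightarrow> ?R")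
proof -
  have h: "i < n \<and> j \<le> w ! i + 1 \<longleftrightarrow> i < n \<and> (j = 0 \<or> j = 1) \<or> i \<in> peaks \<and> j = 2" for i j
    using letter_eq[of i] peaks_less[of i] by (auto split: if_splits)
  have v: "(\<exists>c<n. (i = c \<or> i = Suc c) \<and> j \<le> w ! c) \<longleftrightarrow>
      i \<le> n \<and> j = 0 \<or> i \<in> peak_sides \<and> j = 1" for i j
  proof
    assume "\<exists>c<n. (i = c \<or> i = Suc c) \<and> j \<le> w ! c"
    then show "i \<le> n \<and> j = 0 \<or> i \<in> peak_sides \<and> j = 1"
      by (auto simp: letter_eq peak_sides_def split: if_splits)
  next
    have "\<exists>c<n. i = c \<or> i = Suc c" if "i \<le> n"
      using that n_pos by (cases i) (auto simp: Suc_le_eq)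
    moreover have "\<exists>c<n. (i = c \<or> i = Suc c) \<and> w ! c = 1" if "i \<in> peak_sides"
      using that by (auto simp: peak_sides_def peaks_def)
    moreover assume "i \<le> n \<and> j = 0 \<or> i \<in> peak_sides \<and> j = 1"
    ultimately show "\<exists>c<n. (i = c \<or> i = Suc c) \<and> j \<le> w ! c"
      by (metis le_refl zero_le)
  qed
  have "e \<in> snd (bargraph w) \<longleftrightarrow> (\<exists>i j. e = hedge i j \<and> i < n \<and> j \<le> w ! i + 1) \<or>
      (\<exists>i j. e = vedge i j \<and> (\<exists>c<n. (i = c \<or> i = Suc c) \<and> j \<le> w ! c))"
    unfolding edges_bargraph length_w by blast
  also have "\<dots> \<longleftrightarrow> ?R" unfolding h v by blast
  finally show ?thesis .
qed

text \<open>Writing the abscissa as \<open>Suc m\<close> names the left neighbour without truncated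
  subtraction.\<close>

lemma degree_level_0:
  assumes "Suc m < n"
  shows "degree (bargraph w) (Suc m, 0) = 3"
proof -
  have "{e \<in> snd (bargraph w). (Suc m, 0) \<in> e} = {hedge m 0, hedge (Suc m) 0, vedge (Suc m) 0}"
    using assms by (auto simp: edges_fib_bargraph in_hedge_iff in_vedge_iff hedge_eq_iff vedge_eq_iff
      hedge_neq_vedge)
  then show ?thesis
    by (simp add: degree_def hedge_eq_iff hedge_neq_vedge)
qed

lemma degree_level_1:
  assumes "Suc m < n"
  shows "degree (bargraph w) (Suc m, 1) = (if Suc m \<in> peak_sides then 4 else 3)"
proof -
  have "{e \<in> snd (bargraph w). (Suc m, 1) \<in> e} =
      {hedge m 1, hedge (Suc m) 1, vedge (Suc m) 0} \<union>
      (if Suc m \<in> peak_sides then {vedge (Suc m) 1} else {})"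
    using assms by (auto simp: edges_fib_bargraph in_hedge_iff in_vedge_iff hedge_eq_iff vedge_eq_iff
      hedge_neq_vedge)
  then show ?thesis
    by (simp add: degree_def hedge_eq_iff vedge_eq_iff hedge_neq_vedge)
qed

text \<open>No edge goes up from level 2, and horizontal edges on both sides would need two adjacent
  peaks.\<close>

lemma degree_level_2: "degree (bargraph w) (x, 2) \<le> 2"
proof -
  obtain h where "{e \<in> snd (bargraph w). (x, 2) \<in> e} \<subseteq> {vedge x 1, h}"
  proof (cases "x \<in> peaks")
    case True
    then have "\<forall>i\<in>peaks. x \<noteq> Suc i" using Suc_notin_peaks by blast
    then show ?thesis
      by (intro that[of "hedge x 2"]) (auto simp: edges_fib_bargraph in_hedge_iff in_vedge_iff hedge_eq_iff vedge_eq_iff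
      hedge_neq_vedge)
  next
    case False
    \<comment> \<open>Only an edge from the left is possible. For \<open>x = 0\<close> there is
      none, and the witness \<open>hedge 0 2\<close> does no harm to the inclusion.\<close>
    then show ?thesis
      by (intro that[of "hedge (x - 1) 2"])
         (auto simp: edges_fib_bargraph in_hedge_iff in_vedge_iff hedge_eq_iff vedge_eq_iff
      hedge_neq_vedge)
  qed
  then have "degree (bargraph w) (x, 2) \<le> card {vedge x 1, h}"
    unfolding degree_def by (intro card_mono) auto
  also have "\<dots> \<le> 2" by (simp add: card_insert_if)
  finally show ?thesis .
qed

text \<open>\<open>S\<close> holds the degree-3 vertices off the end lines. The upper slack allows
  for the four points of the end lines on levels 0 and 1, the lower slack for the two end lines left
  out of \<open>A\<close>. Adding \<open>2 * sum_list w\<close> avoids subtraction on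
  naturals.\<close>

lemma deg3_bargraph_bounds:
  "2 * n \<le> deg3 (bargraph w) + 2 * sum_list w + 2"
  "deg3 (bargraph w) + 2 * sum_list w \<le> 2 * n + 4"
proof -
  define D where "D = {v \<in> fst (bargraph w). degree (bargraph w) v = 3}"
  define A where "A = {1..<n} - peak_sides"
  define S where "S = {1..<n} \<times> {0::nat} \<union> A \<times> {1}"
  have finA: "finite A" by (simp add: A_def)
  have cardS: "card S = (n - 1) + card A"
    unfolding S_def by (subst card_Un_disjoint) (auto simp: finA card_cartesian_product)
  have inner: "degree (bargraph w) (x, 0) = 3"
      "degree (bargraph w) (x, 1) = 3 \<longleftrightarrow> x \<notin> peak_sides" if "x \<in> {1..<n}" for x
    using that degree_level_0[of "x - 1"] degree_level_1[of "x - 1"] by auto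
  have SD: "S \<subseteq> D"
    using inner by (auto simp: S_def A_def D_def vertices_bargraph)
  have DS: "D \<subseteq> S \<union> {0, n} \<times> {0, 1}"
  proof
    fix v assume v: "v \<in> D"
    obtain x y where xy: "v = (x, y)" by fastforce
    have "degree (bargraph w) (x, y) = 3" using v xy by (simp add: D_def)
    moreover from this have "y \<noteq> 2" using degree_level_2[of x] by auto
    moreover from this have "x \<le> n" "y = 0 \<or> y = 1"
      using v xy by (auto simp: D_def vertices_bargraph)
    ultimately show "v \<in> S \<union> {0, n} \<times> {0, 1}"
      using inner(2)[of x] xy by (auto simp: S_def A_def)
  qed
  have finD: "finite D"
    by (simp add: D_def vertices_bargraph finite_peak_sides)
  have finS: "finite S" by (simp add: S_def finA)
  have "card S \<le> card D" by (rule card_mono[OF finD SD])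
  moreover have "card D \<le> card S + 4"
  proof -
    have "card D \<le> card (S \<union> {0, n} \<times> {0, 1})"
      by (rule card_mono[OF _ DS]) (simp add: finS)
    also have "\<dots> \<le> card S + card ({0, n} \<times> {0, 1::nat})" by (rule card_Un_le)
    also have "card ({0, n} \<times> {0, 1::nat}) = 4"
      using n_pos by (simp add: card_cartesian_product)
    finally show ?thesis by simp
  qed
  moreover have compl: "card ({..n} - peak_sides) + 2 * sum_list w = n + 1"
    using card_mono[OF _ peak_sides_subset] card_peak_sides
    by (simp add: card_Diff_subset finite_peak_sides peak_sides_subset)
  moreover have "card A \<le> card ({..n} - peak_sides)"
    by (rule card_mono) (auto simp: A_def)
  moreover have "card ({..n} - peak_sides) \<le> card A + 2"
  proof -
    have "card ({..n} - peak_sides) \<le> card (A \<union> {0, n})"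
      by (rule card_mono) (auto simp: A_def)
    also have "\<dots> \<le> card A + card {0, n}" by (rule card_Un_le)
    finally show ?thesis using n_pos by simp
  qed
  moreover have "deg3 (bargraph w) = card D" by (simp add: deg3_def D_def)
  ultimately show "2 * n \<le> deg3 (bargraph w) + 2 * sum_list w + 2"
    "deg3 (bargraph w) + 2 * sum_list w \<le> 2 * n + 4"
    using cardS n_pos by linarith+
qed

end

section \<open>The limit\<close>

lemma V_total_eq:
  assumes "n > 0"
  shows "V_total n = 2 * (n + 1) * card (fib_words n) + 2 * (\<Sum>w\<in>fib_words n. sum_list w)"
proof -
  have "V_total n = (\<Sum>w\<in>fib_words n. 2 * (n + 1) + 2 * sum_list w)"
    unfolding V_total_def using assms by (intro sum.cong refl ver_bargraph)
  then show ?thesis by (simp only: sum.distrib sum_constant flip: sum_distrib_left) simp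
qed

text \<open>The error per word lies between -2 and 4; the summed error is then negligible against
  \<open>n\<close> times the number of words.\<close>

lemma D3_total_bounds:
  assumes "n > 0"
  shows "\<bar>real (D3_total n) - (2 * real n * real (card (fib_words n))
           - 2 * real (\<Sum>w\<in>fib_words n. sum_list w))\<bar> \<le> 4 * real (card (fib_words n))"
proof -
  have "real (D3_total n) - (2 * real n * real (card (fib_words n))
      - 2 * real (\<Sum>w\<in>fib_words n. sum_list w)) =
      (\<Sum>w\<in>fib_words n. real (deg3 (bargraph w)) - (2 * real n - 2 * real (sum_list w)))"
    by (simp add: D3_total_def sum_subtractf sum_distrib_left)
  also have "\<bar>\<dots>\<bar> \<le> (\<Sum>w\<in>fib_words n. 4)"
  proof (rule sum_abs[THEN order_trans], rule sum_mono)
    fix w assume "w \<in> fib_words n"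
    from deg3_bargraph_bounds[OF this assms]
    show "\<bar>real (deg3 (bargraph w)) - (2 * real n - 2 * real (sum_list w))\<bar> \<le> 4"
      by linarith
  qed
  finally show ?thesis by (simp add: mult.commute)
qed

theorem theorem3p10:
  shows "(\<lambda>n. real (D3_total n) / real (V_total n)) \<longlonglongrightarrow> (4 + sqrt 5) / 11"
proof -
  define F where "F n = real (card (fib_words n))" for n
  define K where "K n = real (\<Sum>w\<in>fib_words n. sum_list w)" for n
  \<comment> \<open>Both totals are normalised by \<open>real n * F n\<close>;
    \<open>\<kappa>\<close> is the density of ones, \<open>\<epsilon>\<close> the error in the
    degree-3 count.\<close>
  define \<kappa> where "\<kappa> n = K n / (real n * F n)" for n
  define p where "p = (5 - sqrt 5) / 10"
  define \<epsilon> where "\<epsilon> n = (real (D3_total n) - (2 * real n * F n - 2 * K n)) / (real n * F n)" for n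
  have F_pos: "F n > 0" for n
    unfolding F_def card_fib_words of_nat_0_less_iff by (rule fib_neq_0_nat) simp
  have \<kappa>: "\<kappa> \<longlonglongrightarrow> p"
    using ones_density_tendsto unfolding \<kappa>_def F_def K_def p_def .
  have "\<forall>\<^sub>F n in sequentially. norm (\<epsilon> n) \<le> norm (1 / real n) * 4"
    using eventually_gt_at_top[of 0]
  proof eventually_elim
    case (elim n)
    have "\<bar>real (D3_total n) - (2 * real n * F n - 2 * K n)\<bar> \<le> 4 * F n"
      using D3_total_bounds[OF elim] unfolding F_def K_def .
    then show ?case
      using elim F_pos[of n] by (simp add: \<epsilon>_def abs_mult field_simps)
  qed
  then have \<epsilon>: "\<epsilon> \<longlonglongrightarrow> 0" by (rule tendsto_0_le[OF lim_1_over_n])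
  \<comment> \<open>Positivity of \<open>p\<close> keeps the limiting denominator
    \<open>2 + 2 * p\<close> away from 0.\<close>
  have "sqrt 5 < sqrt 9" by (subst real_sqrt_less_iff) simp
  then have "p > 0" by (simp add: p_def)
  then have lim: "(\<lambda>n. (2 - 2 * \<kappa> n + \<epsilon> n) / (2 + 2 * (1 / real n) + 2 * \<kappa> n))
      \<longlonglongrightarrow> (2 - 2 * p + 0) / (2 + 2 * 0 + 2 * p)"
    by (intro tendsto_intros \<kappa> \<epsilon> lim_1_over_n) auto
  have limit_eq: "(2 - 2 * p + 0) / (2 + 2 * 0 + 2 * p) = (4 + sqrt 5) / 11"
  proof -
    have "2 - 2 * p = 1 + sqrt 5 / 5" "2 + 2 * p = 3 - sqrt 5 / 5"
      unfolding p_def by (simp_all add: diff_divide_distrib)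
    moreover have "(1 + sqrt 5 / 5) * 11 = (4 + sqrt 5) * (3 - sqrt 5 / 5)"
    proof -
      \<comment> \<open>The last term is 1, which leaves 11 times
        \<open>1 + sqrt 5 / 5\<close>.\<close>
      have "(4 + sqrt 5) * (3 - sqrt 5 / 5) = 12 + 11 / 5 * sqrt 5 - sqrt 5 * sqrt 5 / 5"
        by (simp only: distrib_left distrib_right left_diff_distrib right_diff_distrib)
      then show ?thesis by simp
    qed
    ultimately have "(2 - 2 * p) * 11 = (4 + sqrt 5) * (2 + 2 * p)" by (simp only:)
    moreover have "2 + 2 * p \<noteq> 0" using \<open>p > 0\<close> by simp
    ultimately show ?thesis by (simp add: frac_eq_eq)
  qed
  have "\<forall>\<^sub>F n in sequentially.
      (2 - 2 * \<kappa> n + \<epsilon> n) / (2 + 2 * (1 / real n) + 2 * \<kappa> n) = real (D3_total n) / real (V_total n)"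
    using eventually_gt_at_top[of 0]
  proof eventually_elim
    case (elim n)
    define N where "N = real n * F n"
    have N: "N > 0" using elim F_pos[of n] by (simp add: N_def)
    have V: "real (V_total n) = 2 * (real n + 1) * F n + 2 * K n"
      using V_total_eq[OF elim] by (simp add: F_def K_def algebra_simps)
    have "2 - 2 * \<kappa> n + \<epsilon> n = real (D3_total n) / N"
      using elim F_pos[of n] by (simp add: \<kappa>_def \<epsilon>_def N_def field_simps)
    moreover have "2 + 2 * (1 / real n) + 2 * \<kappa> n = real (V_total n) / N"
      using elim F_pos[of n] by (simp add: \<kappa>_def V N_def field_simps)
    ultimately show ?case using N by simp
  qed
  then show ?thesis by (rule Lim_transform_eventually[OF lim[unfolded limit_eq]])
qed

end
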